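(* Let $N>p>1$, $s>-p$, $0<\mu<\bar\mu:=\big(\frac{N-p}{p}\big)^p$ and $p^*_s-1<q<\bar q$, so that $h(\gamma_* )>\mu$. For $x>0$, $Y>0$ define $$V(x,Y):=(q-p+1)(p-1)\left[\frac{x^p}{p}-\gamma_*\frac{x^{p-1}}{p-1}\right]+\big(Y-Y_*\ln Y\big),\qquad Y_*:=h(\gamma_* )-\mu .$$ Then, along any solution with $x>0$, $Y>0$ of the system $$\dot x=\frac{x^{2-p}}{p-1}\big[\mu+Y-h(x)\big],\qquad \dot Y=(q-p+1)\,Y\,(\gamma_*-x),\qquad(\mathrm S)$$ one has $$\frac{d}{dt}V\big(x(t),Y(t)\big)=-(q-p+1)\,(x-\gamma_* )\big(h(x)-h(\gamma_* )\big).$$ Let $\gamma_*^\sharp$ be the unique number in $\big(\frac{N-p}{p},\frac{N-p}{p-1}\big)$ with $h(\gamma_*^\sharp)=h(\gamma_* )$. Then $V$ is a Lyapunov function on the strip $\{0<x<\gamma_*^\sharp,\ Y>0\}$: one has $\dot V\le0$ there, with equality exactly on the segment $\{x=\gamma_*\}$. Setting $$c_0:=V\big(\gamma_*^\sharp,Y_*\big),\qquad \mathcal W:=\text{the connected component of }\{V<c_0\}\text{ containing }P_*=(\gamma_*,Y_* ),$$ the set $\mathcal W$ is an open bounded forward-invariant (for $(\mathrm S)$) neighbourhood of $P_*$ contained in $\{0<x<\gamma_*^\sharp\}$, and every solution $v$ on an interval $(R_0,+\infty)$, $R_0>0$, of $$-\big(r^{N-1}|v'|^{p-2}v'\big)'=\mu\,r^{N-1-p}v^{p-1}+r^{N-1+s}v^{q}$$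 whose orbit enters $\mathcal W$ satisfies $$\lim_{r\to+\infty}r^{\gamma_*}v(r)=\big(h(\gamma_* )-\mu\big)^{\frac1{q-p+1}},\qquad \lim_{r\to+\infty}\frac{r\,v'(r)}{v(r)}=-\gamma_* .$$
   Context: $N,p,s,\mu,q$ are real parameters. A solution of the ODE on $(R_0,+\infty)$ means a positive function $v\in C^1((R_0,+\infty))$ such that $r\mapsto r^{N-1}|v'|^{p-2}v'$ is of class $C^1$ and the equation holds pointwise. Notation: $h(\gamma):=\gamma^{p-1}\big(N-p-(p-1)\gamma\big)$ for $\gamma>0$; $\nu_-<\nu_+$ are the two roots of $h(\nu)=\mu$, which satisfy $0<\nu_-<\frac{N-p}{p}<\nu_+<\frac{N-p}{p-1}$; $\gamma_*:=\frac{p+s}{q-p+1}$; $p^*_s:=\frac{p(N+s)}{N-p}$; $\bar q:=p-1+\frac{p+s}{\nu_-}$. The condition $p^*_s-1<q<\bar q$ is equivalent to $\nu_-<\gamma_*<\frac{N-p}{p}$. The orbit associated with $v$ is $x(t):=-\frac{r v'(r)}{v(r)}$, $Y(t):=r^{p+s}v(r)^{q-p+1}$, $t=\ln r$, where $v'<0$; it solves $(\mathrm S)$. The sublevel set $\{V<c_0\}$ is taken in the domain $\{x>0,\ Y>0\}$ of $V$. *)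

theory Defs
  imports "HOL-Analysis.Analysis"
begin

definition h :: "real \<Rightarrow> real \<Rightarrow> real \<Rightarrow> real" where
  "h N p \<gamma> = \<gamma> powr (p - 1) * (N - p - (p - 1) * \<gamma>)"

definition mu_bar :: "real \<Rightarrow> real \<Rightarrow> real" where
  "mu_bar N p = ((N - p) / p) powr p"

definition p_star :: "real \<Rightarrow> real \<Rightarrow> real \<Rightarrow> real" where
  "p_star N p s = p * (N + s) / (N - p)"

text \<open>The smaller of the two positive roots of \<open>h \<nu> = \<mu>\<close>; there are exactly two of them for
  \<open>0 < \<mu> < mu_bar N p\<close>.\<close>
definition nu_minus :: "real \<Rightarrow> real \<Rightarrow> real \<Rightarrow> real" where
  "nu_minus N p \<mu> = (LEAST \<nu>. 0 < \<nu> \<and> h N p \<nu> = \<mu>)"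

definition q_bar :: "real \<Rightarrow> real \<Rightarrow> real \<Rightarrow> real \<Rightarrow> real" where
  "q_bar N p s \<mu> = p - 1 + (p + s) / nu_minus N p \<mu>"

definition gamma_star :: "real \<Rightarrow> real \<Rightarrow> real \<Rightarrow> real" where
  "gamma_star p s q = (p + s) / (q - p + 1)"

definition Y_star :: "real \<Rightarrow> real \<Rightarrow> real \<Rightarrow> real \<Rightarrow> real \<Rightarrow> real" where
  "Y_star N p s \<mu> q = h N p (gamma_star p s q) - \<mu>"

definition P_star :: "real \<Rightarrow> real \<Rightarrow> real \<Rightarrow> real \<Rightarrow> real \<Rightarrow> real \<times> real" where
  "P_star N p s \<mu> q = (gamma_star p s q, Y_star N p s \<mu> q)"

definition gamma_sharp :: "real \<Rightarrow> real \<Rightarrow> real \<Rightarrow> real \<Rightarrow> real" where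
  "gamma_sharp N p s q =
    (THE g. g \<in> {(N - p) / p<..<(N - p) / (p - 1)} \<and> h N p g = h N p (gamma_star p s q))"

definition quadrant :: "(real \<times> real) set" where
  "quadrant = {(x, Y). 0 < x \<and> 0 < Y}"

definition V :: "real \<Rightarrow> real \<Rightarrow> real \<Rightarrow> real \<Rightarrow> real \<Rightarrow> real \<times> real \<Rightarrow> real" where
  "V N p s \<mu> q = (\<lambda>(x, Y).
     (q - p + 1) * (p - 1) * (x powr p / p - gamma_star p s q * (x powr (p - 1) / (p - 1)))
     + (Y - Y_star N p s \<mu> q * ln Y))"

definition field_S :: "real \<Rightarrow> real \<Rightarrow> real \<Rightarrow> real \<Rightarrow> real \<Rightarrow> real \<times> real \<Rightarrow> real \<times> real" where
  "field_S N p s \<mu> q = (\<lambda>(x, Y).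
     (x powr (2 - p) / (p - 1) * (\<mu> + Y - h N p x),
      (q - p + 1) * Y * (gamma_star p s q - x)))"

text \<open>Solutions of the autonomous system on an arbitrary time interval \<open>I\<close>, with values in the open
  quadrant; derivatives are one-sided at those end points that belong to \<open>I\<close>.\<close>
definition solves_S ::
  "real \<Rightarrow> real \<Rightarrow> real \<Rightarrow> real \<Rightarrow> real \<Rightarrow> real set \<Rightarrow> (real \<Rightarrow> real \<times> real) \<Rightarrow> bool" where
  "solves_S N p s \<mu> q I z \<longleftrightarrow> is_interval I \<and>
     (\<forall>t\<in>I. z t \<in> quadrant \<and> (z has_vector_derivative field_S N p s \<mu> q (z t)) (at t within I))"

text \<open>Forward invariance: a solution that is in \<open>W\<close> at some time stays in \<open>W\<close> at all later times
  at which it exists.\<close>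
definition forward_invariant_S ::
  "real \<Rightarrow> real \<Rightarrow> real \<Rightarrow> real \<Rightarrow> real \<Rightarrow> (real \<times> real) set \<Rightarrow> bool" where
  "forward_invariant_S N p s \<mu> q W \<longleftrightarrow>
     (\<forall>I z. solves_S N p s \<mu> q I z \<longrightarrow>
       (\<forall>t\<^sub>0\<in>I. z t\<^sub>0 \<in> W \<longrightarrow> (\<forall>t\<in>I. t\<^sub>0 \<le> t \<longrightarrow> z t \<in> W)))"

text \<open>The orbital derivative of \<open>V\<close>, as a function on phase space.\<close>
definition V_dot :: "real \<Rightarrow> real \<Rightarrow> real \<Rightarrow> real \<Rightarrow> real \<Rightarrow> real \<times> real \<Rightarrow> real" where
  "V_dot N p s \<mu> q z = frechet_derivative (V N p s \<mu> q) (at z) (field_S N p s \<mu> q z)"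

definition strip :: "real \<Rightarrow> real \<Rightarrow> real \<Rightarrow> real \<Rightarrow> (real \<times> real) set" where
  "strip N p s q = {(x, Y). 0 < x \<and> x < gamma_sharp N p s q \<and> 0 < Y}"

definition c_zero :: "real \<Rightarrow> real \<Rightarrow> real \<Rightarrow> real \<Rightarrow> real \<Rightarrow> real" where
  "c_zero N p s \<mu> q = V N p s \<mu> q (gamma_sharp N p s q, Y_star N p s \<mu> q)"

definition basin :: "real \<Rightarrow> real \<Rightarrow> real \<Rightarrow> real \<Rightarrow> real \<Rightarrow> (real \<times> real) set" where
  "basin N p s \<mu> q =
     connected_component_set {z \<in> quadrant. V N p s \<mu> q z < c_zero N p s \<mu> q} (P_star N p s \<mu> q)"

text \<open>At \<open>v' = 0\<close> the flux is \<open>0\<close>, also for \<open>p < 2\<close>, since \<open>0 powr a = 0\<close>.\<close>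
definition flux :: "real \<Rightarrow> real \<Rightarrow> (real \<Rightarrow> real) \<Rightarrow> real \<Rightarrow> real" where
  "flux N p v r = r powr (N - 1) * \<bar>deriv v r\<bar> powr (p - 2) * deriv v r"

definition radial_solution ::
  "real \<Rightarrow> real \<Rightarrow> real \<Rightarrow> real \<Rightarrow> real \<Rightarrow> real \<Rightarrow> (real \<Rightarrow> real) \<Rightarrow> bool" where
  "radial_solution N p s \<mu> q R\<^sub>0 v \<longleftrightarrow>
     (\<forall>r>R\<^sub>0. 0 < v r) \<and>
     v C1_differentiable_on {R\<^sub>0<..} \<and>
     flux N p v C1_differentiable_on {R\<^sub>0<..} \<and>
     (\<forall>r>R\<^sub>0. - deriv (flux N p v) r =
        \<mu> * r powr (N - 1 - p) * v r powr (p - 1) + r powr (N - 1 + s) * v r powr q)"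

definition orbit :: "real \<Rightarrow> real \<Rightarrow> real \<Rightarrow> (real \<Rightarrow> real) \<Rightarrow> real \<Rightarrow> real \<times> real" where
  "orbit p s q v t = (let r = exp t in
     (- (r * deriv v r / v r), r powr (p + s) * v r powr (q - p + 1)))"

end

theory Submission
  imports Defs
begin

text \<open>\<open>V\<close> splits as \<open>F x + G Y\<close>, where \<open>F\<close> and \<open>G\<close> decrease up to \<open>\<gamma>\<^sub>*\<close> and \<open>Y\<^sub>*\<close> and increase
  afterwards. Hence \<open>{V < c\<^sub>0}\<close> is starlike about \<open>P\<^sub>*\<close>, so it is its own component, and
  \<open>V < c\<^sub>0 = F \<gamma>\<^sup>\<sharp> + G Y\<^sub>*\<close> forces \<open>x < \<gamma>\<^sup>\<sharp>\<close>, where \<open>V\<close> decreases along solutions. Trapped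
  orbits stay in a compact subset of the quadrant, and Barbalat's lemma gives convergence.

  For a radial solution the flux is strictly decreasing, so \<open>v' < 0\<close> persists once it holds. Only
  the flux is assumed differentiable, not \<open>v'\<close>; therefore the equation for \<open>x\<close> is derived from that
  of \<open>x\<^bsup>p-1\<^esup> = - r\<^bsup>p-N\<^esup> \<cdot> flux \<cdot> v\<^bsup>1-p\<^esup>\<close>.\<close>

section \<open>Real-variable lemmas\<close>

lemma has_real_derivative_at_of_within:
  fixes f :: "real \<Rightarrow> real"
  assumes "(f has_real_derivative D) (at x within I)" "{a..b} \<subseteq> I" "a < x" "x < b"
  shows "(f has_real_derivative D) (at x)"
  using DERIV_subset[OF assms(1,2)] assms(3,4) by (simp add: at_within_Icc_at)

text \<open>Solutions may have only one-sided derivatives at end points of their time interval,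
  hence derivatives within \<open>I\<close>. Inside \<open>{a..b}\<close> they become two-sided; at
  \<open>a\<close> and \<open>b\<close> continuity is enough.\<close>

lemma mono_of_deriv_within:
  fixes f f' :: "real \<Rightarrow> real"
  assumes "a \<le> b" and sub: "{a..b} \<subseteq> I"
    and d: "\<And>t. t \<in> {a..b} \<Longrightarrow> (f has_real_derivative f' t) (at t within I)"
    and nn: "\<And>t. a < t \<Longrightarrow> t < b \<Longrightarrow> 0 \<le> f' t"
  shows "f a \<le> f b"
proof (rule DERIV_nonneg_imp_increasing_open[OF \<open>a \<le> b\<close>])
  show "\<exists>y. DERIV f x :> y \<and> 0 \<le> y" if "a < x" "x < b" for x
  proof (intro exI conjI)
    show "DERIV f x :> f' x"
      by (rule has_real_derivative_at_of_within[OF d sub]) (use that in auto)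
    show "0 \<le> f' x" using nn that by blast
  qed
  show "continuous_on {a..b} f"
    by (rule DERIV_continuous_on, rule DERIV_subset[OF d sub])
qed

text \<open>Fits a Lyapunov function whose decrease is known only inside its own sublevel set. Up to
  the first time at which \<open>f\<close> reaches \<open>c\<close> it does not increase, so its
  value there is at most \<open>f a < c\<close>, a contradiction; hence \<open>f\<close> stays below
  \<open>c\<close> throughout.\<close>

lemma le_initial_value_of_deriv_nonpos_below:
  fixes f f' :: "real \<Rightarrow> real"
  assumes "a \<le> b" and sub: "{a..b} \<subseteq> I"
    and d: "\<And>t. t \<in> {a..b} \<Longrightarrow> (f has_real_derivative f' t) (at t within I)"
    and le: "\<And>t. t \<in> {a..b} \<Longrightarrow> f t < c \<Longrightarrow> f' t \<le> 0"
    and "f a < c"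
  shows "f b \<le> f a"
proof -
  have cont: "continuous_on {a..b} f"
    by (rule DERIV_continuous_on, rule DERIV_subset[OF d sub])
  have dec: "f t \<le> f a" if "t \<in> {a..b}" "\<And>u. a < u \<Longrightarrow> u < t \<Longrightarrow> f u < c" for t
  proof -
    have "- f a \<le> - f t"
      by (rule mono_of_deriv_within[where I = I and f' = "\<lambda>u. - f' u"])
         (use that sub in \<open>auto intro!: DERIV_minus d le\<close>)
    then show ?thesis by simp
  qed
  let ?E = "{a..b} \<inter> f -` {c..}"
  have "compact ?E"
    using continuous_closed_preimage[OF cont closed_atLeastAtMost closed_atLeast, of c]
    by (simp add: compact_eq_bounded_closed bounded_Int)
  moreover have False if ne: "?E \<noteq> {}" and "compact ?E"
  proof -
    obtain t where t: "t \<in> ?E" "\<And>u. u \<in> ?E \<Longrightarrow> t \<le> u"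
      using compact_attains_inf[OF \<open>compact ?E\<close> ne] by blast
    have "f t \<le> f a"
    proof (rule dec)
      show "f u < c" if "a < u" "u < t" for u
        using t(2)[of u] t(1) that by (auto simp: not_le[symmetric])
    qed (use t in auto)
    with t(1) \<open>f a < c\<close> show False by auto
  qed
  ultimately have E: "?E = {}" by blast
  show ?thesis
  proof (rule dec)
    show "f u < c" if "a < u" "u < b" for u
    proof (rule ccontr)
      assume "\<not> f u < c"
      then have "u \<in> ?E" using that by auto
      then show False using E by blast
    qed
  qed (use \<open>a \<le> b\<close> in auto)
qed

text \<open>After the last time in \<open>{a..b}\<close> with \<open>c \<le> f t\<close> the
  function is below \<open>c\<close> and so cannot decrease, which gives
  \<open>f t \<le> f b\<close>.\<close>

lemma ge_barrier_of_deriv_nonneg_below: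
  fixes f f' :: "real \<Rightarrow> real"
  assumes "a \<le> b" and sub: "{a..b} \<subseteq> I"
    and d: "\<And>t. t \<in> {a..b} \<Longrightarrow> (f has_real_derivative f' t) (at t within I)"
    and ge: "\<And>t. t \<in> {a..b} \<Longrightarrow> f t < c \<Longrightarrow> 0 \<le> f' t"
    and "c \<le> f a"
  shows "c \<le> f b"
proof -
  have cont: "continuous_on {a..b} f"
    by (rule DERIV_continuous_on, rule DERIV_subset[OF d sub])
  let ?E = "{a..b} \<inter> f -` {c..}"
  have comp: "compact ?E"
    using continuous_closed_preimage[OF cont closed_atLeastAtMost closed_atLeast, of c]
    by (simp add: compact_eq_bounded_closed bounded_Int)
  have ne: "?E \<noteq> {}" using assms by auto
  obtain t where t: "t \<in> ?E" "\<And>u. u \<in> ?E \<Longrightarrow> u \<le> t"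
    using compact_attains_sup[OF comp ne] by blast
  have "f t \<le> f b"
  proof (rule mono_of_deriv_within[where f = f and I = I and f' = f'])
    show "0 \<le> f' u" if "t < u" "u < b" for u
      using t(2)[of u] t(1) that by (intro ge) (auto simp: not_le[symmetric])
  qed (use t sub in \<open>auto intro: d\<close>)
  with t show ?thesis by auto
qed

lemma uniformly_continuous_on_bounded_vector_derivative:
  fixes z :: "real \<Rightarrow> 'a::real_normed_vector"
  assumes "convex I"
    and d: "\<And>t. t \<in> I \<Longrightarrow> (z has_vector_derivative z' t) (at t within I)"
    and B: "\<And>t. t \<in> I \<Longrightarrow> norm (z' t) \<le> B"
  shows "uniformly_continuous_on I z"
proof -
  \<comment> \<open>\<open>\<bar>B\<bar>\<close> replaces \<open>B\<close> because a Lipschitz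
    constant must be nonnegative, and for empty \<open>I\<close> the bound \<open>B\<close> may be
    negative.\<close>
  have "norm (z t - z u) \<le> \<bar>B\<bar> * norm (t - u)" if "t \<in> I" "u \<in> I" for t u
  proof (rule differentiable_bound[OF \<open>convex I\<close> _ _ that])
    show "(z has_derivative (\<lambda>x. x *\<^sub>R z' t)) (at t within I)" if "t \<in> I" for t
      using d[OF that] by (simp add: has_vector_derivative_def)
    show "onorm (\<lambda>x. x *\<^sub>R z' t) \<le> \<bar>B\<bar>" if "t \<in> I" for t
    proof (rule onorm_bound)
      show "norm (x *\<^sub>R z' t) \<le> \<bar>B\<bar> * norm x" for x :: real
        using mult_right_mono[OF order_trans[OF B[OF that] abs_ge_self], of "\<bar>x\<bar>"]
        by (simp add: mult.commute)
    qed simp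
  qed
  then have "\<bar>B\<bar>-lipschitz_on I z"
    by (intro lipschitz_onI) (auto simp: dist_norm)
  then show ?thesis by (rule lipschitz_on_uniformly_continuous)
qed

text \<open>Over a window of fixed length the mean of \<open>f'\<close> is an increment of
  \<open>f\<close> divided by that length, hence small once \<open>f\<close> has nearly converged.
  Uniform continuity carries this from the mean value point to the start of the window.\<close>

lemma barbalat:
  fixes f f' :: "real \<Rightarrow> real"
  assumes d: "\<And>t. a \<le> t \<Longrightarrow> (f has_real_derivative f' t) (at t within {a..})"
    and uc: "uniformly_continuous_on {a..} f'"
    and lim: "(f \<longlongrightarrow> L) at_top"
  shows "(f' \<longlongrightarrow> 0) at_top"
proof (rule tendstoI)
  fix e :: real assume e: "0 < e"
  obtain d where d0: "0 < d"
    and close: "\<And>t u. a \<le> t \<Longrightarrow> a \<le> u \<Longrightarrow> dist t u < d \<Longrightarrow> dist (f' t) (f' u) < e / 2"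
    using uc[unfolded uniformly_continuous_on_def, rule_format, of "e/2"] e by auto
  \<comment> \<open>Two values this close to \<open>L\<close> differ by less than
    \<open>e * d / 4\<close>, which is \<open>e / 2\<close> times the window length
    \<open>d / 2\<close>; the other \<open>e / 2\<close> comes from \<open>close\<close>.\<close>
  have "eventually (\<lambda>t. dist (f t) L < e * d / 8) at_top"
    using lim e d0 by (intro tendstoD) auto
  then obtain T where T: "\<And>t. T \<le> t \<Longrightarrow> dist (f t) L < e * d / 8"
    by (auto simp: eventually_at_top_linorder)
  show "eventually (\<lambda>t. dist (f' t) 0 < e) at_top"
    unfolding eventually_at_top_linorder
  proof (intro exI[of _ "max T a"] allI impI)
    fix t assume t: "max T a \<le> t"
    have D: "(f has_real_derivative f' x) (at x)" if "t < x" "x < t + d / 2" for x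
      by (rule has_real_derivative_at_of_within[OF assms(1), of _ t "t + d/2"]) (use that t in auto)
    have "continuous_on {t..t + d / 2} f"
      by (rule DERIV_continuous_on[where D = f'], rule DERIV_subset[OF assms(1)]) (use t in auto)
    then obtain l x where x: "t < x" "x < t + d / 2" "DERIV f x :> l"
        "f (t + d / 2) - f t = (t + d / 2 - t) * l"
      using MVT[of t "t + d/2" f] D d0 by (auto simp: real_differentiable_def)
    have "l = f' x" using DERIV_unique x(3) D[OF x(1,2)] by blast
    then have eq: "d / 2 * f' x = f (t + d / 2) - f t" using x(4) by simp
    have "\<bar>f t - L\<bar> < e * d / 8" "\<bar>f (t + d/2) - L\<bar> < e * d / 8"
      using T[of t] T[of "t + d/2"] t d0 by (simp_all add: dist_real_def)
    then have "\<bar>f (t + d/2) - f t\<bar> < e * d / 4" by linarith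
    then have "d / 2 * \<bar>f' x\<bar> < d / 2 * (e / 2)"
      using d0 by (simp add: eq[symmetric] abs_mult mult.commute[of e])
    then have "\<bar>f' x\<bar> < e / 2" using d0 by (simp add: mult_less_cancel_left_pos)
    moreover have "dist (f' t) (f' x) < e / 2"
      by (rule close) (use t x d0 in \<open>auto simp: dist_real_def\<close>)
    ultimately show "dist (f' t) 0 < e" unfolding dist_real_def by linarith
  qed
qed

lemma antimono_bounded_below_converges:
  fixes f :: "real \<Rightarrow> real"
  assumes anti: "\<And>t u. a \<le> t \<Longrightarrow> t \<le> u \<Longrightarrow> f u \<le> f t"
    and low: "\<And>t. a \<le> t \<Longrightarrow> B \<le> f t"
  shows "\<exists>L. (f \<longlongrightarrow> L) at_top"
proof (intro exI order_tendstoI)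
  let ?L = "INF t\<in>{a..}. f t"
  have bdd: "bdd_below (f ` {a..})" using low by (auto intro: bdd_belowI2[of _ B])
  fix c
  show "eventually (\<lambda>t. c < f t) at_top" if "c < ?L"
    using eventually_ge_at_top[of a]
    by eventually_elim (use that cINF_lower[OF bdd] in \<open>fastforce intro: less_le_trans\<close>)
  show "eventually (\<lambda>t. f t < c) at_top" if "?L < c"
  proof -
    obtain t where t: "a \<le> t" "f t < c"
      using \<open>?L < c\<close> cINF_less_iff[OF _ bdd] by auto
    then show ?thesis
      using anti by (auto simp: eventually_at_top_linorder intro!: exI[of _ t] intro: le_less_trans)
  qed
qed

text \<open>On the compact set \<open>K - U\<close> the function \<open>\<bar>g\<bar>\<close> has a
  positive minimum, so points of \<open>K\<close> with smaller \<open>\<bar>g\<bar>\<close> lie in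
  \<open>U\<close>.\<close>

lemma tendsto_unique_zero_on_compact:
  fixes g :: "'a::metric_space \<Rightarrow> real"
  assumes K: "compact K" and g: "continuous_on K g"
    and zero: "\<And>x. x \<in> K \<Longrightarrow> g x = 0 \<Longrightarrow> x = c"
    and fK: "eventually (\<lambda>t. f t \<in> K) F" and lim: "((\<lambda>t. g (f t)) \<longlongrightarrow> 0) F"
  shows "(f \<longlongrightarrow> c) F"
proof (rule topological_tendstoI)
  fix U assume U: "open U" "c \<in> U"
  show "eventually (\<lambda>t. f t \<in> U) F"
  proof (cases "K - U = {}")
    case True
    then show ?thesis using fK by (auto elim: eventually_mono)
  next
    case False
    have "compact (K - U)" using K U(1) by (rule compact_diff)
    moreover have "continuous_on (K - U) (\<lambda>x. \<bar>g x\<bar>)"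
      using continuous_on_subset[OF g] by (intro continuous_intros) auto
    ultimately obtain x where x: "x \<in> K - U" "\<And>y. y \<in> K - U \<Longrightarrow> \<bar>g x\<bar> \<le> \<bar>g y\<bar>"
      using continuous_attains_inf[of "K - U" "\<lambda>x. \<bar>g x\<bar>"] False by auto
    have "0 < \<bar>g x\<bar>" using zero[of x] x(1) U(2) by auto
    then have "eventually (\<lambda>t. \<bar>g (f t)\<bar> < \<bar>g x\<bar>) F"
      using tendstoD[OF lim] by (simp add: dist_real_def)
    with fK show ?thesis by eventually_elim (use x(2) in fastforce)
  qed
qed

lemma C1_has_real_derivative:
  fixes f :: "real \<Rightarrow> real"
  assumes "f C1_differentiable_on S" "x \<in> S"
  shows "(f has_real_derivative deriv f x) (at x)"
proof -
  obtain D where "(f has_vector_derivative D) (at x)"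
    using assms unfolding C1_differentiable_on_def by blast
  then have "(f has_real_derivative D) (at x)"
    by (simp add: has_real_derivative_iff_has_vector_derivative)
  then show ?thesis by (simp add: DERIV_imp_deriv)
qed

text \<open>With the derivative written as value times logarithmic derivative \<open>l\<close>, a
  power merely multiplies \<open>l\<close> by the exponent; products of powers of \<open>r\<close>
  and \<open>v\<close> then stay factored.\<close>

lemma powr_has_log_derivative:
  fixes f :: "real \<Rightarrow> real"
  assumes "0 < f x" "(f has_real_derivative f x * l) (at x)"
  shows "((\<lambda>x. f x powr a) has_real_derivative f x powr a * (a * l)) (at x)"
proof -
  have "f x powr (a - 1) * f x = f x powr a"
    using assms(1) by (simp add: powr_diff)
  then have "a * f x powr (a - 1) * (f x * l) = f x powr a * (a * l)"
    by (simp add: mult_ac)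
  with DERIV_fun_powr[OF assms(2,1), of a] show ?thesis by simp
qed

section \<open>The function h and the flux\<close>

lemma h_has_derivative:
  assumes "0 < x"
  shows "(h N p has_real_derivative (p - 1) * x powr (p - 2) * (N - p - p * x)) (at x)"
proof -
  have "x powr (p - 1) = x powr (p - 2) * x"
    using assms powr_add[of x "p - 2" 1] by simp
  then show ?thesis
    unfolding h_def[abs_def] using assms
    by (auto intro!: derivative_eq_intros simp: algebra_simps)
qed

text \<open>The point 0 is included because \<open>p - 1 > 0\<close>. For \<open>p < 2\<close>
  differentiability may fail there, but the intermediate value theorem is applied from 0 on.\<close>

lemma continuous_on_h: "1 < p \<Longrightarrow> continuous_on {0..} (h N p)"
  unfolding h_def[abs_def] by (intro continuous_on_mult continuous_on_powr' continuous_intros) auto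

lemma h_strict_mono:
  assumes "1 < p" "0 \<le> x" "x < y" "y \<le> (N - p) / p"
  shows "h N p x < h N p y"
proof (rule DERIV_pos_imp_increasing_open[OF \<open>x < y\<close>])
  show "\<exists>d. DERIV (h N p) t :> d \<and> 0 < d" if "x < t" "t < y" for t
  proof (rule exI, rule conjI, rule h_has_derivative)
    have "t * p < N - p"
      using assms that less_le_trans[of t y "(N - p) / p"] by (simp add: pos_less_divide_eq)
    then show "0 < (p - 1) * t powr (p - 2) * (N - p - p * t)"
      using assms that by (intro mult_pos_pos) (auto simp: mult.commute)
    show "0 < t" using assms that by simp
  qed
  show "continuous_on {x..y} (h N p)"
    using continuous_on_subset[OF continuous_on_h] assms by auto
qed

lemma h_strict_antimono:
  assumes "1 < p" "p < N" "(N - p) / p \<le> x" "x < y"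
  shows "h N p y < h N p x"
proof (rule DERIV_neg_imp_decreasing_open[OF \<open>x < y\<close>])
  have x0: "0 < x" using assms less_le_trans[of 0 "(N - p) / p" x] by auto
  show "\<exists>d. DERIV (h N p) t :> d \<and> d < 0" if "x < t" "t < y" for t
  proof (rule exI, rule conjI, rule h_has_derivative)
    have "N - p < t * p"
      using assms that le_less_trans[of "(N - p) / p" x t] by (simp add: pos_divide_less_eq)
    then show "(p - 1) * t powr (p - 2) * (N - p - p * t) < 0"
      using assms that x0 by (intro mult_pos_neg mult_pos_pos) (auto simp: mult.commute)
    show "0 < t" using x0 that by simp
  qed
  show "continuous_on {x..y} (h N p)"
    using continuous_on_subset[OF continuous_on_h] assms x0 by auto
qed

lemma h_zero: "h N p 0 = 0"
  by (simp add: h_def)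

text \<open>The linear factor of \<open>h\<close> takes the value \<open>(N - p) / p\<close> here
  too, so the exponents \<open>p - 1\<close> and \<open>1\<close> add up to
  \<open>p\<close>.\<close>

lemma h_at_maximum:
  assumes "1 < p" "p < N"
  shows "h N p ((N - p) / p) = mu_bar N p"
proof -
  have "N - p - (p - 1) * ((N - p) / p) = ((N - p) / p) powr 1"
    using assms by (simp add: field_simps)
  then show ?thesis
    unfolding h_def mu_bar_def by (simp only: powr_add[symmetric]) simp
qed

text \<open>Translates monotonicity of the flux into information on the sign of
  \<open>deriv v r\<close>.\<close>

lemma flux_neg_iff:
  assumes "0 < r"
  shows "flux N p v r < 0 \<longleftrightarrow> deriv v r < 0"
proof (cases "deriv v r = 0")
  case False
  then have "0 < r powr (N - 1) * \<bar>deriv v r\<bar> powr (p - 2)" using assms by simp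
  then show ?thesis unfolding flux_def by (simp only: mult_less_0_iff) auto
qed (simp add: flux_def)

section \<open>The phase plane\<close>

locale supercritical =
  fixes N p s \<mu> q :: real
  assumes p_gt1: "1 < p" and p_less: "p < N" and s_gt: "- p < s"
    and mu_pos: "0 < \<mu>" and mu_less: "\<mu> < mu_bar N p"
    and q_gt: "p_star N p s - 1 < q" and q_less: "q < q_bar N p s \<mu>"
begin

abbreviation "m \<equiv> q - p + 1"
abbreviation "\<gamma> \<equiv> gamma_star p s q"
abbreviation "\<gamma>\<^sub>1 \<equiv> gamma_sharp N p s q"
abbreviation "Ys \<equiv> Y_star N p s \<mu> q"
abbreviation "\<nu> \<equiv> nu_minus N p \<mu>"
abbreviation "VV \<equiv> V N p s \<mu> q"

section \<open>Position of the exponents relative to the maximum point of \<open>h\<close>\<close>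

lemma m_gt: "p * (p + s) / (N - p) < m"
proof -
  have "p_star N p s - p = p * (p + s) / (N - p)"
    using p_less by (simp add: p_star_def field_simps)
  then show ?thesis using q_gt by simp
qed

lemma m_pos: "0 < m"
proof -
  have "0 < p * (p + s) / (N - p)"
    using p_gt1 p_less s_gt by (intro divide_pos_pos mult_pos_pos) auto
  then show ?thesis using m_gt by linarith
qed

lemma gamma_pos: "0 < \<gamma>"
  unfolding gamma_star_def using m_pos s_gt by (intro divide_pos_pos) auto

text \<open>\<open>m_gt\<close> is the lower bound on \<open>q\<close> shifted by
  \<open>p - 1\<close>; dividing \<open>p + s\<close> by both of its sides gives the claim.\<close>

lemma gamma_less: "\<gamma> < (N - p) / p"
  using m_gt m_pos p_gt1 p_less by (simp add: gamma_star_def field_simps)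

lemma gamma_mult_m: "\<gamma> * m = p + s"
  using m_pos by (simp add: gamma_star_def)

text \<open>A \<open>LEAST\<close> over the reals must be shown to be attained. The intermediate
  value theorem supplies a root left of the maximum point, and strict monotonicity there excludes
  any smaller positive root.\<close>

lemma nu_root: "0 < \<nu> \<and> h N p \<nu> = \<mu> \<and> \<nu> < (N - p) / p"
proof -
  have "\<exists>x\<ge>0. x \<le> (N - p) / p \<and> h N p x = \<mu>"
    using p_gt1 p_less mu_pos mu_less
    by (intro IVT') (auto simp: h_zero h_at_maximum
        intro: continuous_on_subset[OF continuous_on_h])
  then obtain x where x: "0 \<le> x" "x \<le> (N - p) / p" "h N p x = \<mu>" by blast
  have "x \<noteq> 0" "x \<noteq> (N - p) / p"
    using x(3) mu_pos mu_less h_at_maximum[OF p_gt1 p_less] by (auto simp: h_zero)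
  then have x': "0 < x" "x < (N - p) / p" using x by auto
  have "\<nu> = x"
    unfolding nu_minus_def
  proof (rule Least_equality)
    show "x \<le> y" if "0 < y \<and> h N p y = \<mu>" for y
      using h_strict_mono[OF p_gt1, of y x N] that x by fastforce
  qed (use x x' in auto)
  then show ?thesis using x x' by simp
qed

lemma nu_less_gamma: "\<nu> < \<gamma>"
proof -
  have "m < (p + s) / \<nu>" using q_less by (simp add: q_bar_def)
  then show ?thesis
    using nu_root m_pos by (simp add: gamma_star_def field_simps)
qed

lemma mu_less_h_gamma: "\<mu> < h N p \<gamma>"
  using h_strict_mono[OF p_gt1, of \<nu> \<gamma> N] nu_root nu_less_gamma gamma_less by auto

lemma Ys_pos: "0 < Ys"
  using mu_less_h_gamma by (simp add: Y_star_def)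

text \<open>On this interval \<open>h\<close> falls strictly from its maximum, which exceeds
  \<open>h N p \<gamma>\<close>, to 0, which lies below it because
  \<open>h N p \<gamma> > \<mu> > 0\<close>.\<close>

lemma ex1_sharp: "\<exists>!g. g \<in> {(N - p) / p<..<(N - p) / (p - 1)} \<and> h N p g = h N p \<gamma>"
proof -
  have le: "(N - p) / p \<le> (N - p) / (p - 1)"
    using p_gt1 p_less by (intro divide_left_mono) auto
  have end0: "h N p ((N - p) / (p - 1)) = 0" using p_gt1 by (simp add: h_def)
  have max: "h N p \<gamma> < h N p ((N - p) / p)"
    using h_strict_mono[OF p_gt1] gamma_pos gamma_less by simp
  have pos: "0 < h N p \<gamma>" using mu_pos mu_less_h_gamma by linarith
  have "\<exists>x\<ge>(N - p) / p. x \<le> (N - p) / (p - 1) \<and> h N p x = h N p \<gamma>"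
  proof (rule IVT2')
    have "{(N - p) / p..(N - p) / (p - 1)} \<subseteq> {0..}"
      using p_gt1 p_less order_trans[of 0 "(N - p) / p"] by auto
    then show "continuous_on {(N - p) / p..(N - p) / (p - 1)} (h N p)"
      by (rule continuous_on_subset[OF continuous_on_h[OF p_gt1]])
  qed (use max pos end0 le in auto)
  then obtain x where x: "(N - p) / p \<le> x" "x \<le> (N - p) / (p - 1)" "h N p x = h N p \<gamma>"
    by blast
  have "x \<noteq> (N - p) / p" "x \<noteq> (N - p) / (p - 1)" using x(3) max pos end0 by auto
  with x have "x \<in> {(N - p) / p<..<(N - p) / (p - 1)} \<and> h N p x = h N p \<gamma>" by auto
  then show ?thesis
  proof (rule ex1I)
    fix y assume "y \<in> {(N - p) / p<..<(N - p) / (p - 1)} \<and> h N p y = h N p \<gamma>"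
    then show "y = x"
      using h_strict_antimono[OF p_gt1 p_less, of x y]
        h_strict_antimono[OF p_gt1 p_less, of y x] x
      by (cases x y rule: linorder_cases) auto
  qed
qed

lemma sharp: "(N - p) / p < \<gamma>\<^sub>1" "h N p \<gamma>\<^sub>1 = h N p \<gamma>"
  using theI'[OF ex1_sharp] by (auto simp: gamma_sharp_def)

text \<open>\<open>h\<close> first increases, then decreases, and takes the same value at
  \<open>\<gamma>\<close> and \<open>\<gamma>\<^sub>1\<close>; so it is below that value left of
  \<open>\<gamma>\<close> and above it strictly between the two points.\<close>

lemma h_sign:
  assumes "0 < x" "x < \<gamma>\<^sub>1"
  shows "0 \<le> (x - \<gamma>) * (h N p x - h N p \<gamma>)"
    and "(x - \<gamma>) * (h N p x - h N p \<gamma>) = 0 \<longleftrightarrow> x = \<gamma>"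
proof -
  have less: "h N p x < h N p \<gamma>" if "x < \<gamma>"
    using h_strict_mono[OF p_gt1 _ that] assms gamma_less by auto
  have greater: "h N p \<gamma> < h N p x" if "\<gamma> < x"
  proof (cases "x \<le> (N - p) / p")
    case True
    then show ?thesis using h_strict_mono[OF p_gt1 _ that] gamma_pos by simp
  next
    case False
    then show ?thesis
      using h_strict_antimono[OF p_gt1 p_less, of x \<gamma>\<^sub>1] assms(2) sharp(2) by simp
  qed
  show "0 \<le> (x - \<gamma>) * (h N p x - h N p \<gamma>)"
    using less greater by (cases x \<gamma> rule: linorder_cases) (simp_all add: mult_nonpos_nonpos)
  show "(x - \<gamma>) * (h N p x - h N p \<gamma>) = 0 \<longleftrightarrow> x = \<gamma>"
    using less greater by (cases x \<gamma> rule: linorder_cases) simp_all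
qed

section \<open>The two separated summands of \<open>V\<close>\<close>

definition F :: "real \<Rightarrow> real" where
  "F x = m * (p - 1) * (x powr p / p - \<gamma> * (x powr (p - 1) / (p - 1)))"

definition G :: "real \<Rightarrow> real" where
  "G Y = Y - Ys * ln Y"

lemma V_eq: "VV z = F (fst z) + G (snd z)"
  by (simp add: V_def F_def G_def split_beta)

lemma F_deriv:
  assumes "0 < x"
  shows "(F has_real_derivative m * (p - 1) * x powr (p - 2) * (x - \<gamma>)) (at x)"
proof -
  have *: "x powr (p - 1) = x powr (p - 2) * x"
    using assms powr_add[of x "p - 2" 1] by simp
  have D: "((\<lambda>x. x powr p / p) has_real_derivative x powr (p - 1)) (at x)"
    "((\<lambda>x. x powr (p - 1) / (p - 1)) has_real_derivative x powr (p - 2)) (at x)"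
    using assms p_gt1 by (auto intro!: derivative_eq_intros)
  have "(F has_real_derivative m * (p - 1) * (x powr (p - 1) - \<gamma> * x powr (p - 2))) (at x)"
    unfolding F_def[abs_def] by (intro DERIV_cmult DERIV_diff D)
  moreover have "m * (p - 1) * (x powr (p - 1) - \<gamma> * x powr (p - 2))
      = m * (p - 1) * x powr (p - 2) * (x - \<gamma>)"
    unfolding * by (simp add: algebra_simps)
  ultimately show ?thesis by simp
qed

lemma G_deriv: "0 < Y \<Longrightarrow> (G has_real_derivative 1 - Ys / Y) (at Y)"
  unfolding G_def[abs_def] by (auto intro!: derivative_eq_intros)

lemma F_continuous_on: "continuous_on {0<..} F"
  by (auto intro!: continuous_at_imp_continuous_on DERIV_isCont[OF F_deriv])

lemma G_continuous_on: "continuous_on {0<..} G"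
  by (auto intro!: continuous_at_imp_continuous_on DERIV_isCont[OF G_deriv])

lemma F_dec:
  assumes "0 < x" "x < y" "y \<le> \<gamma>"
  shows "F y < F x"
proof (rule DERIV_neg_imp_decreasing_open[OF \<open>x < y\<close>])
  show "\<exists>d. DERIV F t :> d \<and> d < 0" if "x < t" "t < y" for t
    by (rule exI, rule conjI, rule F_deriv)
       (use assms that m_pos p_gt1 in \<open>auto intro!: mult_pos_neg\<close>)
  show "continuous_on {x..y} F"
    by (rule continuous_on_subset[OF F_continuous_on]) (use assms in auto)
qed

lemma F_inc:
  assumes "\<gamma> \<le> x" "x < y"
  shows "F x < F y"
proof (rule DERIV_pos_imp_increasing_open[OF \<open>x < y\<close>])
  show "\<exists>d. DERIV F t :> d \<and> 0 < d" if "x < t" "t < y" for t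
    by (rule exI, rule conjI, rule F_deriv)
       (use assms that m_pos p_gt1 gamma_pos in auto)
  show "continuous_on {x..y} F"
    by (rule continuous_on_subset[OF F_continuous_on]) (use assms gamma_pos in auto)
qed

lemma G_dec:
  assumes "0 < x" "x < y" "y \<le> Ys"
  shows "G y < G x"
proof (rule DERIV_neg_imp_decreasing_open[OF \<open>x < y\<close>])
  show "\<exists>d. DERIV G t :> d \<and> d < 0" if "x < t" "t < y" for t
    by (rule exI, rule conjI, rule G_deriv) (use assms that in auto)
  show "continuous_on {x..y} G"
    by (rule continuous_on_subset[OF G_continuous_on]) (use assms in auto)
qed

lemma G_inc:
  assumes "Ys \<le> x" "x < y"
  shows "G x < G y"
proof (rule DERIV_pos_imp_increasing_open[OF \<open>x < y\<close>])
  show "\<exists>d. DERIV G t :> d \<and> 0 < d" if "x < t" "t < y" for t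
    by (rule exI, rule conjI, rule G_deriv) (use assms that Ys_pos in auto)
  show "continuous_on {x..y} G"
    by (rule continuous_on_subset[OF G_continuous_on]) (use assms Ys_pos in auto)
qed

lemma F_segment_le:
  assumes "0 < x" "0 \<le> u" "u \<le> 1"
  shows "F ((1 - u) * \<gamma> + u * x) \<le> F x"
proof -
  \<comment> \<open>The same point measured from \<open>x\<close> and from \<open>\<gamma>\<close>,
    so that each of the two comparisons reduces to the sign of a product.\<close>
  have conv: "(1 - u) * \<gamma> + u * x = x + (1 - u) * (\<gamma> - x)"
    "(1 - u) * \<gamma> + u * x = \<gamma> + u * (x - \<gamma>)" by algebra+
  show ?thesis
  proof (cases "x \<le> \<gamma>")
    case True
    have "x \<le> (1 - u) * \<gamma> + u * x" unfolding conv(1) using True assms by simp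
    moreover have "(1 - u) * \<gamma> + u * x \<le> \<gamma>"
      unfolding conv(2) using True assms by (simp add: mult_nonneg_nonpos)
    ultimately show ?thesis
      using F_dec[OF \<open>0 < x\<close>] by (fastforce simp: order_le_less)
  next
    case False
    have "(1 - u) * \<gamma> + u * x \<le> x"
      unfolding conv(1) using False assms by (simp add: mult_nonneg_nonpos)
    moreover have "\<gamma> \<le> (1 - u) * \<gamma> + u * x"
      unfolding conv(2) using False assms by simp
    ultimately show ?thesis using F_inc by (fastforce simp: order_le_less)
  qed
qed

lemma G_segment_le:
  assumes "0 < x" "0 \<le> u" "u \<le> 1"
  shows "G ((1 - u) * Ys + u * x) \<le> G x"
proof -
  have conv: "(1 - u) * Ys + u * x = x + (1 - u) * (Ys - x)"
    "(1 - u) * Ys + u * x = Ys + u * (x - Ys)" by algebra+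
  show ?thesis
  proof (cases "x \<le> Ys")
    case True
    have "x \<le> (1 - u) * Ys + u * x" unfolding conv(1) using True assms by simp
    moreover have "(1 - u) * Ys + u * x \<le> Ys"
      unfolding conv(2) using True assms by (simp add: mult_nonneg_nonpos)
    ultimately show ?thesis
      using G_dec[OF \<open>0 < x\<close>] by (fastforce simp: order_le_less)
  next
    case False
    have "(1 - u) * Ys + u * x \<le> x"
      unfolding conv(1) using False assms by (simp add: mult_nonneg_nonpos)
    moreover have "Ys \<le> (1 - u) * Ys + u * x"
      unfolding conv(2) using False assms by simp
    ultimately show ?thesis using G_inc by (fastforce simp: order_le_less)
  qed
qed

lemma F_ge: "0 < x \<Longrightarrow> F \<gamma> \<le> F x"
  using F_segment_le[of x 0] by simp

lemma G_ge: "0 < Y \<Longrightarrow> G Ys \<le> G Y"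
  using G_segment_le[of Y 0] by simp

text \<open>\<open>G\<close> tends to infinity at both ends of the half-line: near 0 through the
  logarithm, at infinity through the linear term.\<close>

lemma G_sublevel_bounds: "\<exists>l>0. \<exists>u. \<forall>Y>0. G Y \<le> C \<longrightarrow> l \<le> Y \<and> Y \<le> u"
proof (rule exI[of _ "exp (- C / Ys)"], intro exI[of _ "2 * (C + Ys * (ln (2 * Ys) - 1))"] conjI allI impI)
  fix Y :: real assume Y: "0 < Y" "G Y \<le> C"
  have "- C \<le> Ys * ln Y" using Y by (simp add: G_def)
  then have "- C / Ys \<le> ln Y" using Ys_pos by (simp add: field_simps)
  then show "exp (- C / Ys) \<le> Y" using Y by (simp add: ln_ge_iff)
  \<comment> \<open>The tangent of \<open>ln\<close> at \<open>2 * Ys\<close> has slope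
    \<open>1 / (2 * Ys)\<close>, so the logarithmic term absorbs only half of
    \<open>Y\<close>.\<close>
  have "ln (Y / (2 * Ys)) \<le> Y / (2 * Ys) - 1"
    using Y Ys_pos by (intro ln_le_minus_one) auto
  then have "Ys * ln Y \<le> Ys * (Y / (2 * Ys) - 1 + ln (2 * Ys))"
    using Y Ys_pos by (intro mult_left_mono) (auto simp: ln_div)
  also have "\<dots> = Y / 2 + Ys * (ln (2 * Ys) - 1)" using Ys_pos by (simp add: field_simps)
  finally show "Y \<le> 2 * (C + Ys * (ln (2 * Ys) - 1))"
    using Y(2) by (simp add: G_def field_simps)
qed simp

section \<open>Sublevel set and orbital derivative of \<open>V\<close>\<close>

definition sublevel :: "(real \<times> real) set" where
  "sublevel = {z \<in> quadrant. VV z < c_zero N p s \<mu> q}"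

lemma c_zero_eq: "c_zero N p s \<mu> q = F \<gamma>\<^sub>1 + G Ys"
  by (simp add: c_zero_def V_eq)

lemma P_star_in_sublevel: "P_star N p s \<mu> q \<in> sublevel"
  using gamma_pos Ys_pos F_inc[of \<gamma> \<gamma>\<^sub>1] gamma_less sharp(1)
  by (simp add: sublevel_def quadrant_def P_star_def V_eq c_zero_eq)

text \<open>Lets every later argument work with the plain inequality \<open>V < c_zero\<close>
  instead of a connected component.\<close>

lemma basin_eq: "basin N p s \<mu> q = sublevel"
proof -
  have "starlike sublevel"
    unfolding starlike_def
  proof (intro bexI[OF _ P_star_in_sublevel] ballI subsetI)
    fix z w assume z: "z \<in> sublevel" and "w \<in> closed_segment (P_star N p s \<mu> q) z"
    then obtain u where u: "0 \<le> u" "u \<le> 1" and "w = (1 - u) *\<^sub>R P_star N p s \<mu> q + u *\<^sub>R z"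
      unfolding in_segment by blast
    then have w: "w = ((1 - u) * \<gamma> + u * fst z, (1 - u) * Ys + u * snd z)"
      by (simp add: P_star_def prod_eq_iff)
    have pos: "0 < fst z" "0 < snd z" using z by (auto simp: sublevel_def quadrant_def)
    have "0 < (1 - u) * c + u * d" if "0 < c" "0 < d" for c d :: real
      using u that by (cases "u = 0") (auto intro!: add_nonneg_pos)
    then have "w \<in> quadrant" using w pos gamma_pos Ys_pos by (simp add: quadrant_def)
    moreover have "VV w \<le> VV z"
      unfolding V_eq w using F_segment_le[OF pos(1) u] G_segment_le[OF pos(2) u] by simp
    ultimately show "w \<in> sublevel" using z by (simp add: sublevel_def)
  qed
  then have "connected sublevel" by (rule starlike_imp_connected)
  then show ?thesis
    unfolding basin_def sublevel_def[symmetric]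
    using P_star_in_sublevel by (intro connected_component_eq_self) auto
qed

lemma V_has_derivative:
  assumes "z \<in> quadrant"
  shows "(VV has_derivative (\<lambda>w. m * (p - 1) * fst z powr (p - 2) * (fst z - \<gamma>) * fst w
    + (1 - Ys / snd z) * snd w)) (at z)"
proof -
  have pos: "0 < fst z" "0 < snd z" using assms by (auto simp: quadrant_def)
  have "((\<lambda>z. F (fst z)) has_derivative
      (\<lambda>w. m * (p - 1) * fst z powr (p - 2) * (fst z - \<gamma>) * fst w)) (at z)"
    using has_derivative_compose[OF bounded_linear_imp_has_derivative[OF bounded_linear_fst]
        F_deriv[OF pos(1), unfolded has_field_derivative_def]] .
  moreover have "((\<lambda>z. G (snd z)) has_derivative (\<lambda>w. (1 - Ys / snd z) * snd w)) (at z)"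
    using has_derivative_compose[OF bounded_linear_imp_has_derivative[OF bounded_linear_snd]
        G_deriv[OF pos(2), unfolded has_field_derivative_def]] .
  ultimately show ?thesis
    unfolding V_eq[abs_def] by (rule has_derivative_add)
qed

lemma quadrant_open: "open quadrant"
proof -
  have *: "quadrant = {0<..} \<times> {0<..}" by (auto simp: quadrant_def)
  show ?thesis unfolding * by (intro open_Times open_greaterThan)
qed

lemma V_continuous_on: "continuous_on quadrant VV"
  using V_has_derivative has_derivative_continuous
  by (force intro!: continuous_at_imp_continuous_on)

lemma sublevel_open: "open sublevel"
proof -
  have "open (quadrant \<inter> VV -` {..<c_zero N p s \<mu> q})"
    by (rule continuous_open_preimage[OF V_continuous_on quadrant_open open_lessThan])
  moreover have "sublevel = quadrant \<inter> VV -` {..<c_zero N p s \<mu> q}"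
    by (auto simp: sublevel_def)
  ultimately show ?thesis by simp
qed

lemma F_sublevel_less:
  assumes "F x < F y" "\<gamma> \<le> y"
  shows "x < y"
  using F_inc[of y x] assms by (cases x y rule: linorder_cases) auto

lemma sublevel_strip: "sublevel \<subseteq> strip N p s q"
proof
  fix z assume "z \<in> sublevel"
  then have z: "0 < fst z" "0 < snd z" "F (fst z) + G (snd z) < F \<gamma>\<^sub>1 + G Ys"
    by (auto simp: sublevel_def quadrant_def V_eq c_zero_eq)
  have "fst z < \<gamma>\<^sub>1"
    using F_sublevel_less[of "fst z" \<gamma>\<^sub>1] z G_ge[of "snd z"] gamma_less sharp(1) by linarith
  then show "z \<in> strip N p s q" using z by (auto simp: strip_def)
qed

lemma sublevel_bounded: "bounded sublevel"
proof -
  \<comment> \<open>At least \<open>F \<gamma>\<close> of the level is used up by \<open>F\<close>,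
    which leaves a bound for \<open>G\<close> alone.\<close>
  obtain l u where u: "\<And>Y. 0 < Y \<Longrightarrow> G Y \<le> c_zero N p s \<mu> q - F \<gamma> \<Longrightarrow> l \<le> Y \<and> Y \<le> u"
    using G_sublevel_bounds by metis
  have "sublevel \<subseteq> cbox (0, 0) (\<gamma>\<^sub>1, u)"
  proof
    fix z assume z: "z \<in> sublevel"
    then have "0 < fst z" "0 < snd z" "fst z < \<gamma>\<^sub>1" and V: "VV z < c_zero N p s \<mu> q"
      using sublevel_strip by (auto simp: strip_def sublevel_def)
    moreover from this have "snd z \<le> u"
      using u[of "snd z"] F_ge[of "fst z"] by (simp add: V_eq)
    ultimately show "z \<in> cbox (0, 0) (\<gamma>\<^sub>1, u)"
      by (cases z) (auto simp: cbox_Pair_eq)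
  qed
  then show ?thesis by (rule bounded_subset[OF bounded_cbox])
qed

text \<open>The weight \<open>(p - 1) * x powr (p - 2)\<close> from \<open>F\<close> is the
  reciprocal of the prefactor in the equation for \<open>x\<close>. What remains is
  \<open>m * (x - \<gamma>)\<close> times \<open>(\<mu> + Y - h N p x) - (Y - Ys)\<close>; here
  \<open>Y\<close> cancels, and \<open>Ys = h N p \<gamma> - \<mu>\<close> leaves a difference of
  values of \<open>h\<close>.\<close>

lemma V_rate:
  assumes "0 < x" "0 < Y"
  shows "m * (p - 1) * x powr (p - 2) * (x - \<gamma>) * (x powr (2 - p) / (p - 1) * (\<mu> + Y - h N p x))
      + (1 - Ys / Y) * (m * Y * (\<gamma> - x))
    = - m * (x - \<gamma>) * (h N p x - h N p \<gamma>)"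
proof -
  have "x powr (p - 2) * x powr (2 - p) = 1"
    using assms by (simp add: powr_add[symmetric])
  moreover have "m * (p - 1) * x powr (p - 2) * (x - \<gamma>) * (x powr (2 - p) / (p - 1) * (\<mu> + Y - h N p x))
      = (x powr (p - 2) * x powr (2 - p)) * ((p - 1) / (p - 1)) * (m * (x - \<gamma>) * (\<mu> + Y - h N p x))"
    by (simp only: divide_inverse mult_ac)
  moreover have "(p - 1) / (p - 1) = 1" using p_gt1 by simp
  ultimately have *: "m * (p - 1) * x powr (p - 2) * (x - \<gamma>) * (x powr (2 - p) / (p - 1) * (\<mu> + Y - h N p x))
      = m * (x - \<gamma>) * (\<mu> + Y - h N p x)"
    by simp
  have "(1 - Ys / Y) * (m * Y * (\<gamma> - x)) = (1 - Ys / Y) * Y * (m * (\<gamma> - x))"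
    by (simp only: mult_ac)
  moreover have "(1 - Ys / Y) * Y = Y - Ys" using assms by (simp add: left_diff_distrib)
  ultimately have **: "(1 - Ys / Y) * (m * Y * (\<gamma> - x)) = (Y - Ys) * (m * (\<gamma> - x))"
    by simp
  show ?thesis unfolding * ** unfolding Y_star_def by algebra
qed

lemma V_dot_eq:
  assumes "z \<in> quadrant"
  shows "V_dot N p s \<mu> q z = - m * (fst z - \<gamma>) * (h N p (fst z) - h N p \<gamma>)"
proof -
  have "V_dot N p s \<mu> q z = m * (p - 1) * fst z powr (p - 2) * (fst z - \<gamma>) *
      fst (field_S N p s \<mu> q z) + (1 - Ys / snd z) * snd (field_S N p s \<mu> q z)"
    unfolding V_dot_def frechet_derivative_at[OF V_has_derivative[OF assms], symmetric] ..
  then show ?thesis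
    using V_rate[of "fst z" "snd z"] assms by (auto simp: field_S_def quadrant_def)
qed

section \<open>Invariance and convergence for solutions of (S)\<close>

lemma solves_pos:
  assumes "solves_S N p s \<mu> q I z" "t \<in> I"
  shows "z t \<in> quadrant" "0 < fst (z t)" "0 < snd (z t)"
proof -
  show "z t \<in> quadrant" using assms by (auto simp: solves_S_def)
  then show "0 < fst (z t)" "0 < snd (z t)" by (auto simp: quadrant_def)
qed

lemma solves_V_deriv:
  assumes "solves_S N p s \<mu> q I z" "t \<in> I"
  shows "((\<lambda>\<tau>. VV (z \<tau>)) has_real_derivative
    - m * (fst (z t) - \<gamma>) * (h N p (fst (z t)) - h N p \<gamma>)) (at t within I)"
proof -
  have z: "z t \<in> quadrant" "(z has_vector_derivative field_S N p s \<mu> q (z t)) (at t within I)"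
    using assms by (auto simp: solves_S_def)
  have D: "m * (p - 1) * fst (z t) powr (p - 2) * (fst (z t) - \<gamma>) * fst (field_S N p s \<mu> q (z t))
      + (1 - Ys / snd (z t)) * snd (field_S N p s \<mu> q (z t))
    = - m * (fst (z t) - \<gamma>) * (h N p (fst (z t)) - h N p \<gamma>)"
    using V_rate[of "fst (z t)" "snd (z t)"] z(1) by (auto simp: field_S_def quadrant_def)
  have "((\<lambda>\<tau>. VV (z \<tau>)) has_derivative (\<lambda>x.
      m * (p - 1) * fst (z t) powr (p - 2) * (fst (z t) - \<gamma>) * fst (x *\<^sub>R field_S N p s \<mu> q (z t))
      + (1 - Ys / snd (z t)) * snd (x *\<^sub>R field_S N p s \<mu> q (z t)))) (at t within I)"
    using has_derivative_compose[OF z(2)[unfolded has_vector_derivative_def]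
        V_has_derivative[OF z(1)]] .
  moreover have "c * (x * A) + d * (x * B) = (c * A + d * B) * x" for c d x A B :: real
    by (simp add: algebra_simps)
  ultimately show ?thesis
    unfolding has_field_derivative_def D[symmetric]
    by (simp only: fst_scaleR snd_scaleR real_scaleR_def)
qed

text \<open>The sign of the rate is known for \<open>x < \<gamma>\<^sub>1\<close>, which holds as
  long as the orbit stays in the sublevel set, which in turn follows from that sign. The first-exit
  argument breaks this circle.\<close>

lemma solves_V_le:
  assumes z: "solves_S N p s \<mu> q I z" and I: "a \<in> I" "b \<in> I" "a \<le> b" and za: "z a \<in> sublevel"
  shows "VV (z b) \<le> VV (z a)"
proof (rule le_initial_value_of_deriv_nonpos_below[where c = "c_zero N p s \<mu> q"
      and f = "\<lambda>\<tau>. VV (z \<tau>)" and I = I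
      and f' = "\<lambda>t. - m * (fst (z t) - \<gamma>) * (h N p (fst (z t)) - h N p \<gamma>)", OF \<open>a \<le> b\<close>])
  show sub: "{a..b} \<subseteq> I"
    using z I mem_is_interval_1_I[of I a b] unfolding solves_S_def by auto
  show "((\<lambda>\<tau>. VV (z \<tau>)) has_real_derivative
    - m * (fst (z t) - \<gamma>) * (h N p (fst (z t)) - h N p \<gamma>)) (at t within I)" if "t \<in> {a..b}" for t
    using solves_V_deriv[OF z] that sub by auto
  show "- m * (fst (z t) - \<gamma>) * (h N p (fst (z t)) - h N p \<gamma>) \<le> 0"
    if "t \<in> {a..b}" "VV (z t) < c_zero N p s \<mu> q" for t
  proof -
    have "t \<in> I" using that sub by auto
    then have "z t \<in> sublevel" using solves_pos(1)[OF z] that by (simp add: sublevel_def)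
    then have "z t \<in> strip N p s q" using sublevel_strip by blast
    then have "0 \<le> (fst (z t) - \<gamma>) * (h N p (fst (z t)) - h N p \<gamma>)"
      by (intro h_sign) (auto simp: strip_def)
    then have "0 \<le> m * ((fst (z t) - \<gamma>) * (h N p (fst (z t)) - h N p \<gamma>))"
      by (rule mult_nonneg_nonneg[OF less_imp_le[OF m_pos]])
    then show ?thesis by (simp only: mult.assoc mult_minus_left neg_le_0_iff_le)
  qed
  show "VV (z a) < c_zero N p s \<mu> q" using za by (simp add: sublevel_def)
qed

lemma sublevel_forward_invariant: "forward_invariant_S N p s \<mu> q sublevel"
  unfolding forward_invariant_S_def
proof (intro allI impI ballI)
  fix I z a b assume *: "solves_S N p s \<mu> q I z" "a \<in> I" "z a \<in> sublevel" "b \<in> I" "a \<le> b"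
  then have "z b \<in> quadrant" by (auto simp: solves_S_def)
  with solves_V_le[OF *(1,2,4,5,3)] *(3) show "z b \<in> sublevel" by (simp add: sublevel_def)
qed

lemma continuous_on_field: "continuous_on quadrant (field_S N p s \<mu> q)"
proof -
  have "continuous_on quadrant (\<lambda>z. h N p (fst z))"
    by (rule continuous_on_compose2[OF continuous_on_h[OF p_gt1]])
       (auto simp: quadrant_def intro!: continuous_intros)
  then show ?thesis
    unfolding field_S_def split_beta using p_gt1
    by (intro continuous_intros) (auto simp: quadrant_def)
qed

lemma solves_components:
  assumes "solves_S N p s \<mu> q I z" "t \<in> I"
  shows "((\<lambda>t. fst (z t)) has_real_derivative fst (field_S N p s \<mu> q (z t))) (at t within I)"
proof -
  have "(z has_vector_derivative field_S N p s \<mu> q (z t)) (at t within I)"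
    using assms by (auto simp: solves_S_def)
  from bounded_linear.has_vector_derivative[OF bounded_linear_fst this]
  show ?thesis by (simp add: has_real_derivative_iff_has_vector_derivative)
qed

text \<open>As \<open>h < \<mu>\<close> on \<open>(0, \<nu>)\<close>, the coordinate \<open>x\<close> increases there; this keeps the orbit away from
  the edge \<open>x = 0\<close>, where \<open>V\<close> gives no control.\<close>

lemma solves_x_lower:
  assumes z: "solves_S N p s \<mu> q {a..} z" and "a \<le> t"
  shows "min (fst (z a)) \<nu> \<le> fst (z t)"
proof (rule ge_barrier_of_deriv_nonneg_below[OF \<open>a \<le> t\<close>, where I = "{a..}"
      and f = "\<lambda>t. fst (z t)" and f' = "\<lambda>t. fst (field_S N p s \<mu> q (z t))"])
  show "((\<lambda>t. fst (z t)) has_real_derivative fst (field_S N p s \<mu> q (z u))) (at u within {a..})"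
    if "u \<in> {a..t}" for u
    using solves_components[OF z] that by auto
  show "0 \<le> fst (field_S N p s \<mu> q (z u))" if u: "u \<in> {a..t}" "fst (z u) < min (fst (z a)) \<nu>" for u
  proof -
    have pos: "0 < fst (z u)" "0 < snd (z u)"
      using solves_pos[OF z, of u] u by auto
    have "h N p (fst (z u)) < \<mu>"
      using h_strict_mono[OF p_gt1, of "fst (z u)" \<nu> N] u nu_root pos by auto
    then show ?thesis
      using pos p_gt1 by (auto simp: field_S_def split_beta)
  qed
qed auto

text \<open>The closure of the sublevel set reaches the line \<open>x = \<gamma>\<^sub>1\<close>,
  where the rate of \<open>V\<close> vanishes as it does at \<open>x = \<gamma>\<close>. The strict
  inequality at time \<open>a\<close> keeps the orbit at a positive distance from that line.\<close>

lemma solves_compact: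
  assumes z: "solves_S N p s \<mu> q {a..} z" and za: "z a \<in> sublevel"
  obtains x0 x1 Y0 Y1 where "0 < x0" "x1 < \<gamma>\<^sub>1" "0 < Y0"
    "\<And>t. a \<le> t \<Longrightarrow> z t \<in> {x0..x1} \<times> {Y0..Y1}"
proof -
  have V: "VV (z t) \<le> VV (z a)" if "a \<le> t" for t
    using solves_V_le[OF z _ _ _ za] that by auto
  have pos: "0 < fst (z t)" "0 < snd (z t)" if "a \<le> t" for t
    using solves_pos[OF z, of t] that by auto
  obtain Y0 Y1 where Y: "0 < Y0"
    "\<And>Y. 0 < Y \<Longrightarrow> G Y \<le> VV (z a) - F \<gamma> \<Longrightarrow> Y0 \<le> Y \<and> Y \<le> Y1"
    using G_sublevel_bounds by metis
  \<comment> \<open>Continuity yields \<open>x1 < \<gamma>\<^sub>1\<close> at which \<open>F\<close>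
    still exceeds \<open>VV (z a) - G Ys\<close>, an upper bound for \<open>F\<close> along the
    orbit.\<close>
  have "isCont F \<gamma>\<^sub>1"
    using F_deriv[of \<gamma>\<^sub>1] DERIV_isCont gamma_pos gamma_less sharp(1) by fastforce
  moreover have "VV (z a) - G Ys < F \<gamma>\<^sub>1"
    using za by (simp add: sublevel_def c_zero_eq)
  ultimately have "eventually (\<lambda>x. VV (z a) - G Ys < F x) (at_left \<gamma>\<^sub>1)"
    by (auto intro: order_tendstoD filterlim_at_split[THEN iffD1, THEN conjunct1] simp: isCont_def)
  moreover have "eventually (\<lambda>x. \<gamma> < x) (at_left \<gamma>\<^sub>1)"
    using gamma_less sharp(1) by (intro eventually_at_leftI[of \<gamma>]) auto
  moreover have "eventually (\<lambda>x. x < \<gamma>\<^sub>1) (at_left \<gamma>\<^sub>1)"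
    by (simp add: eventually_at_filter)
  ultimately have "eventually (\<lambda>x. VV (z a) - G Ys < F x \<and> \<gamma> < x \<and> x < \<gamma>\<^sub>1) (at_left \<gamma>\<^sub>1)"
    by eventually_elim auto
  then obtain x1 where x1: "VV (z a) - G Ys < F x1" "\<gamma> < x1" "x1 < \<gamma>\<^sub>1"
    using eventually_happens'[OF trivial_limit_at_left_real] by blast
  show ?thesis
  proof
    show "0 < min (fst (z a)) \<nu>" using pos[of a] nu_root by auto
    show "x1 < \<gamma>\<^sub>1" by fact
    show "0 < Y0" by fact
    show "z t \<in> {min (fst (z a)) \<nu>..x1} \<times> {Y0..Y1}" if t: "a \<le> t" for t
    proof -
      have "F (fst (z t)) < F x1"
        using V[OF t] G_ge[OF pos(2)[OF t]] x1(1) by (simp add: V_eq)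
      then have "fst (z t) < x1" using F_sublevel_less x1(2) by simp
      moreover have "Y0 \<le> snd (z t) \<and> snd (z t) \<le> Y1"
        using Y(2)[OF pos(2)[OF t]] V[OF t] F_ge[OF pos(1)[OF t]] by (simp add: V_eq)
      ultimately show ?thesis using solves_x_lower[OF z t] by (auto simp: mem_Times_iff)
    qed
  qed
qed

text \<open>LaSalle's principle by applying Barbalat's lemma twice: to \<open>V\<close>, giving \<open>x \<rightarrow> \<gamma>\<close>, and then to
  \<open>x\<close>, giving \<open>\<mu> + Y - h x \<rightarrow> 0\<close>.\<close>

lemma solves_converges:
  assumes z: "solves_S N p s \<mu> q {a..} z" and za: "z a \<in> sublevel"
  shows "((\<lambda>t. fst (z t)) \<longlongrightarrow> \<gamma>) at_top" and "((\<lambda>t. snd (z t)) \<longlongrightarrow> Ys) at_top"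
proof -
  obtain x0 x1 Y0 Y1 where K: "0 < x0" "x1 < \<gamma>\<^sub>1" "0 < Y0"
    "\<And>t. a \<le> t \<Longrightarrow> z t \<in> {x0..x1} \<times> {Y0..Y1}"
    using solves_compact[OF assms] by metis
  let ?K = "{x0..x1} \<times> {Y0..Y1}"
  let ?f = "field_S N p s \<mu> q"
  let ?g = "\<lambda>x. - m * (x - \<gamma>) * (h N p x - h N p \<gamma>)"
  have Kc: "compact ?K" by (intro compact_Times) auto
  have Kq: "?K \<subseteq> quadrant" using K by (auto simp: quadrant_def)
  have fK: "continuous_on ?K ?f" using continuous_on_subset[OF continuous_on_field Kq] .
  obtain B where B: "\<And>w. w \<in> ?K \<Longrightarrow> norm (?f w) \<le> B"
    using compact_imp_bounded[OF compact_continuous_image[OF fK Kc]] by (auto simp: bounded_iff)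
  have ucz: "uniformly_continuous_on {a..} z"
    by (rule uniformly_continuous_on_bounded_vector_derivative[where z' = "\<lambda>t. ?f (z t)" and B = B])
       (use z B K(4) in \<open>auto simp: solves_S_def\<close>)
  \<comment> \<open>Since the orbit is trapped in \<open>?K\<close>, every continuous function of
    the phase point is uniformly continuous in time, as both uses of Barbalat's lemma
    require.\<close>
  have uc: "uniformly_continuous_on {a..} (\<lambda>t. \<Phi> (z t))" if "continuous_on ?K \<Phi>"
    for \<Phi> :: "real \<times> real \<Rightarrow> real"
  proof (rule uniformly_continuous_on_compose[OF ucz])
    have "z ` {a..} \<subseteq> ?K" by (rule image_subsetI, rule K(4)) simp
    then show "uniformly_continuous_on (z ` {a..}) \<Phi>"
      using compact_uniformly_continuous[OF that Kc] unfolding uniformly_continuous_on_def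
      by (meson subsetD)
  qed
  have hK: "continuous_on {x0..x1} (h N p)"
    using continuous_on_subset[OF continuous_on_h[OF p_gt1]] K(1) by auto
  have gK: "continuous_on {x0..x1} ?g"
    by (intro continuous_intros hK)
  have "\<exists>L. ((\<lambda>t. VV (z t)) \<longlongrightarrow> L) at_top"
  proof (rule antimono_bounded_below_converges)
    show "VV (z u) \<le> VV (z t)" if "a \<le> t" "t \<le> u" for t u
    proof (rule solves_V_le[OF z])
      show "z t \<in> sublevel"
        using sublevel_forward_invariant z za that unfolding forward_invariant_S_def by auto
    qed (use that in auto)
    show "F \<gamma> + G Ys \<le> VV (z t)" if "a \<le> t" for t
      using K(4)[OF that] K(1,3) F_ge[of "fst (z t)"] G_ge[of "snd (z t)"]
      by (auto simp: V_eq mem_Times_iff)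
  qed
  then obtain L where L: "((\<lambda>t. VV (z t)) \<longlongrightarrow> L) at_top" ..
  have g0: "((\<lambda>t. ?g (fst (z t))) \<longlongrightarrow> 0) at_top"
  proof (rule barbalat[OF _ _ L])
    show "uniformly_continuous_on {a..} (\<lambda>t. ?g (fst (z t)))"
      by (rule uc[of "\<lambda>w. ?g (fst w)"], rule continuous_on_compose2[OF gK])
         (auto intro!: continuous_intros)
  qed (use solves_V_deriv[OF z] in auto)
  show x: "((\<lambda>t. fst (z t)) \<longlongrightarrow> \<gamma>) at_top"
  proof (rule tendsto_unique_zero_on_compact[OF _ gK _ _ g0])
    show "x = \<gamma>" if "x \<in> {x0..x1}" "?g x = 0" for x
      using h_sign(2)[of x] that K m_pos by auto
    show "eventually (\<lambda>t. fst (z t) \<in> {x0..x1}) at_top"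
      using eventually_ge_at_top[of a] by eventually_elim (use K(4) in \<open>simp add: mem_Times_iff\<close>)
  qed simp
  have dx: "((\<lambda>t. fst (?f (z t))) \<longlongrightarrow> 0) at_top"
  proof (rule barbalat[OF _ _ x])
    show "uniformly_continuous_on {a..} (\<lambda>t. fst (?f (z t)))"
      by (rule uc[of "\<lambda>w. fst (?f w)"]) (intro continuous_intros fK)
  qed (use solves_components[OF z] in auto)
  \<comment> \<open>The first equation of (S), solved for \<open>Y\<close>, turns the limits of
    \<open>x\<close> and of its derivative into the limit of \<open>Y\<close>.\<close>
  have "isCont (h N p) \<gamma>" using h_has_derivative[OF gamma_pos] by (rule DERIV_isCont)
  then have "((\<lambda>t. (p - 1) * fst (z t) powr (p - 2) * fst (?f (z t)) + h N p (fst (z t)) - \<mu>)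
      \<longlongrightarrow> (p - 1) * \<gamma> powr (p - 2) * 0 + h N p \<gamma> - \<mu>) at_top"
    using gamma_pos by (intro tendsto_intros x dx isCont_tendsto_compose[OF _ x]) auto
  moreover have "(p - 1) * fst (z t) powr (p - 2) * fst (?f (z t)) + h N p (fst (z t)) - \<mu> = snd (z t)"
    if "a \<le> t" for t
  proof -
    have "0 < fst (z t)" using K(4)[OF that] K(1) by (auto simp: mem_Times_iff)
    then have "fst (z t) powr (p - 2) * fst (z t) powr (2 - p) = 1"
      by (simp add: powr_add[symmetric])
    then show ?thesis using p_gt1 by (simp add: field_S_def split_beta field_simps)
  qed
  then have "eventually (\<lambda>t. (p - 1) * fst (z t) powr (p - 2) * fst (?f (z t)) + h N p (fst (z t)) - \<mu>
      = snd (z t)) at_top"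
    using eventually_ge_at_top[of a] by (rule eventually_mono[rotated])
  ultimately show "((\<lambda>t. snd (z t)) \<longlongrightarrow> Ys) at_top"
    by (simp add: Y_star_def Lim_transform_eventually)
qed


section \<open>From radial solutions to orbits\<close>

context
  fixes R\<^sub>0 :: real and v :: "real \<Rightarrow> real"
  assumes R0: "0 < R\<^sub>0" and sol: "radial_solution N p s \<mu> q R\<^sub>0 v"
begin

definition U :: "real \<Rightarrow> real" where
  "U r = r powr (p - N) * (- flux N p v r) * v r powr (1 - p)"

definition source :: "real \<Rightarrow> real" where
  "source r = \<mu> * r powr (N - 1 - p) * v r powr (p - 1) + r powr (N - 1 + s) * v r powr q"

lemma v_pos: "R\<^sub>0 < r \<Longrightarrow> 0 < v r"
  using sol by (auto simp: radial_solution_def)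

lemma v_deriv: "R\<^sub>0 < r \<Longrightarrow> (v has_real_derivative deriv v r) (at r)"
  using sol by (auto simp: radial_solution_def intro: C1_has_real_derivative)

lemma flux_deriv:
  assumes "R\<^sub>0 < r"
  shows "(flux N p v has_real_derivative - source r) (at r)"
proof -
  have "(flux N p v has_real_derivative deriv (flux N p v) r) (at r)"
    using sol assms by (auto simp: radial_solution_def intro: C1_has_real_derivative)
  moreover have "deriv (flux N p v) r = - source r"
    using sol assms unfolding radial_solution_def source_def by (metis minus_equation_iff)
  ultimately show ?thesis by simp
qed

text \<open>The source is nonnegative, so minus the flux cannot decrease. A single radius with
  negative derivative thus keeps all later orbit points in the quadrant.\<close>

lemma deriv_neg_persists:
  assumes "R\<^sub>0 < a" "a \<le> b" "deriv v a < 0"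
  shows "deriv v b < 0"
proof -
  have "- flux N p v a \<le> - flux N p v b"
  proof (rule mono_of_deriv_within[where f = "\<lambda>r. - flux N p v r" and f' = source and I = UNIV])
    show "((\<lambda>r. - flux N p v r) has_real_derivative source t) (at t within UNIV)"
      if "t \<in> {a..b}" for t
      using DERIV_minus[OF flux_deriv[of t]] that assms by simp
    show "0 \<le> source t" for t
      using mu_pos by (simp add: source_def)
  qed (use assms in auto)
  moreover have "flux N p v a < 0" using assms R0 by (simp add: flux_neg_iff)
  ultimately have "flux N p v b < 0" by simp
  then show ?thesis using assms R0 by (simp add: flux_neg_iff)
qed

text \<open>For negative \<open>deriv v r\<close> the flux is
  \<open>- (r powr (N - 1) * (- deriv v r) powr (p - 1))\<close>, and the exponents
  \<open>p - N\<close> and \<open>N - 1\<close> of \<open>r\<close> add up to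
  \<open>p - 1\<close>.\<close>

lemma U_eq:
  assumes "R\<^sub>0 < r" "deriv v r < 0"
  shows "U r = (- (r * deriv v r / v r)) powr (p - 1)"
proof -
  have pos: "0 < r" "0 < v r" "0 < - deriv v r" using assms R0 v_pos by auto
  have "(- deriv v r) powr (p - 1) = (- deriv v r) powr (p - 2) * (- deriv v r)"
    using powr_add[of "- deriv v r" "p - 2" 1] pos by simp
  then have "- flux N p v r = r powr (N - 1) * (- deriv v r) powr (p - 1)"
    using pos by (simp add: flux_def)
  then have "U r = (r powr (p - N) * r powr (N - 1)) * (- deriv v r) powr (p - 1) * v r powr (1 - p)"
    by (simp add: U_def)
  also have "\<dots> = r powr (p - 1) * (- deriv v r) powr (p - 1) / v r powr (p - 1)"
    using powr_minus_divide[of "v r" "p - 1"] by (simp add: powr_add[symmetric])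
  also have "\<dots> = (r * (- deriv v r) / v r) powr (p - 1)"
    using pos by (simp only: powr_mult powr_divide less_imp_le mult_nonneg_nonneg)
  finally show ?thesis by simp
qed

text \<open>Product rule for three factors: the two powers contribute their logarithmic derivatives,
  the flux contributes \<open>source\<close>. Where \<open>U r = x powr (p - 1)\<close>, the
  numerator is \<open>\<mu> + Y - h N p x\<close>.\<close>

lemma U_deriv:
  assumes "R\<^sub>0 < r"
  shows "(U has_real_derivative
    ((p - N) * U r + (p - 1) * (- (r * deriv v r / v r)) * U r
      + \<mu> + r powr (p + s) * v r powr m) / r) (at r)"
proof -
  have pos: "0 < r" "0 < v r" using assms R0 v_pos by auto
  define A where "A = r powr (p - N)"
  define C where "C = v r powr (1 - p)"
  define \<Phi> where "\<Phi> = - flux N p v r"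
  have "((\<lambda>r. r powr (p - N)) has_real_derivative A * ((p - N) * (1 / r))) (at r)"
    unfolding A_def using pos by (intro powr_has_log_derivative) auto
  moreover have "((\<lambda>r. v r powr (1 - p)) has_real_derivative C * ((1 - p) * (deriv v r / v r))) (at r)"
    unfolding C_def using pos v_deriv[OF assms] by (intro powr_has_log_derivative) auto
  moreover have "((\<lambda>r. - flux N p v r) has_real_derivative source r) (at r)"
    using DERIV_minus[OF flux_deriv[OF assms]] by simp
  ultimately have "(U has_real_derivative (A * ((p - N) * (1 / r)) * \<Phi> + source r * A) * C
      + C * ((1 - p) * (deriv v r / v r)) * (A * \<Phi>)) (at r)"
    unfolding U_def[abs_def] A_def C_def \<Phi>_def by (intro DERIV_mult)
  \<comment> \<open>The factors \<open>A\<close> and \<open>C\<close> turn the two terms of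
    \<open>source\<close> into \<open>\<mu> / r\<close> and \<open>Y / r\<close>, with
    \<open>Y\<close> the second orbit coordinate.\<close>
  moreover have "source r * A * C = (\<mu> + r powr (p + s) * v r powr m) / r"
  proof -
    have "source r * A * C
      = \<mu> * (r powr (N - 1 - p) * r powr (p - N)) * (v r powr (p - 1) * v r powr (1 - p))
        + (r powr (N - 1 + s) * r powr (p - N)) * (v r powr q * v r powr (1 - p))"
      unfolding source_def A_def C_def by (simp add: algebra_simps)
    also have "r powr (N - 1 - p) * r powr (p - N) = 1 / r"
      using pos by (simp add: powr_add[symmetric] powr_minus_divide)
    also have "v r powr (p - 1) * v r powr (1 - p) = 1"
      using pos by (simp add: powr_add[symmetric])
    also have "r powr (N - 1 + s) * r powr (p - N) = r powr (p + s) / r"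
      using pos powr_diff[of r "p + s" 1] by (simp add: powr_add[symmetric] algebra_simps)
    also have "v r powr q * v r powr (1 - p) = v r powr m"
      by (simp add: powr_add[symmetric] algebra_simps)
    finally show ?thesis by (simp add: add_divide_distrib)
  qed
  moreover have "U r = A * \<Phi> * C" by (simp add: U_def A_def C_def \<Phi>_def)
  moreover have "(A * ((p - N) * (1 / r)) * \<Phi> + S * A) * C + C * ((1 - p) * (deriv v r / v r)) * (A * \<Phi>)
      = ((p - N) * (A * \<Phi> * C) + (p - 1) * (- (r * deriv v r / v r)) * (A * \<Phi> * C)) / r + S * A * C" for S
    using pos by (simp add: field_simps)
  ultimately show ?thesis by (simp add: add_divide_distrib add.assoc)
qed

text \<open>Passing to \<open>ln r\<close> multiplies derivatives by \<open>r\<close> and makes the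
  system autonomous. The first coordinate is differentiated as the power \<open>1 / (p - 1)\<close>
  of \<open>U\<close>.\<close>

lemma orbit_has_vector_derivative:
  assumes t: "ln R\<^sub>0 < t" and neg: "\<And>u. t \<le> u \<Longrightarrow> deriv v (exp u) < 0"
    and "t \<le> \<tau>"
  shows "orbit p s q v \<tau> \<in> quadrant"
    and "(orbit p s q v has_vector_derivative field_S N p s \<mu> q (orbit p s q v \<tau>)) (at \<tau> within {t..})"
proof -
  have R: "R\<^sub>0 < exp u" if "t \<le> u" for u
    using t that R0 by (metis exp_less_mono exp_ln less_le_trans)
  define r where "r = exp \<tau>"
  define x where "x = - (r * deriv v r / v r)"
  define Y where "Y = r powr (p + s) * v r powr m"
  have r: "R\<^sub>0 < r" "0 < r" "0 < v r" "deriv v r < 0"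
    using R[OF \<open>t \<le> \<tau>\<close>] neg[OF \<open>t \<le> \<tau>\<close>] v_pos by (auto simp: r_def)
  have orb: "orbit p s q v \<tau> = (x, Y)"
    by (simp add: orbit_def x_def Y_def r_def Let_def)
  have x: "0 < x" using r by (simp add: x_def divide_neg_pos mult_pos_neg)
  have Y: "0 < Y" using r by (simp add: Y_def)
  show "orbit p s q v \<tau> \<in> quadrant" using x Y by (simp add: orb quadrant_def)
  have root: "U (exp u) powr (1 / (p - 1)) = - (exp u * deriv v (exp u) / v (exp u))" if "t \<le> u" for u
  proof -
    have "0 < - (exp u * deriv v (exp u) / v (exp u))"
      using v_pos[OF R[OF that]] neg[OF that] by (simp add: divide_neg_pos mult_pos_neg)
    moreover have "(y powr (p - 1)) powr (1 / (p - 1)) = y" if "0 < y" for y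
      using that p_gt1 by (simp add: powr_powr)
    ultimately show ?thesis
      unfolding U_eq[OF R[OF that] neg[OF that]] by blast
  qed
  have Ur: "U r = x powr (p - 1)" using U_eq[OF r(1,4)] by (simp add: x_def)
  have U0: "0 < U r" using Ur x by simp
  have hx: "h N p x = - ((p - N) * U r + (p - 1) * x * U r)"
    unfolding h_def Ur by (simp add: algebra_simps)
  have "(U has_real_derivative (\<mu> + Y - h N p x) / r) (at (exp \<tau>))"
    using U_deriv[OF r(1)] unfolding hx x_def[symmetric] Y_def[symmetric] r_def[symmetric]
    by (simp add: algebra_simps)
  from DERIV_chain2[OF this DERIV_exp]
  have "((\<lambda>u. U (exp u)) has_real_derivative \<mu> + Y - h N p x) (at \<tau>)"
    using r by (simp add: r_def)
  \<comment> \<open>Logarithmic form, as required for taking the root.\<close>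
  then have "((\<lambda>u. U (exp u)) has_real_derivative U (exp \<tau>) * ((\<mu> + Y - h N p x) / U r)) (at \<tau>)"
    using U0 by (simp add: r_def)
  from powr_has_log_derivative[OF _ this, of "1 / (p - 1)"]
  have "((\<lambda>u. U (exp u) powr (1 / (p - 1))) has_real_derivative
      x * (1 / (p - 1) * ((\<mu> + Y - h N p x) / x powr (p - 1)))) (at \<tau>)"
    using U0 root[OF \<open>t \<le> \<tau>\<close>] Ur by (simp add: r_def x_def)
  moreover have "x * (1 / (p - 1) * ((\<mu> + Y - h N p x) / x powr (p - 1)))
      = x powr (2 - p) / (p - 1) * (\<mu> + Y - h N p x)"
    using powr_diff[of x 1 "p - 1"] x by simp
  ultimately have dx: "((\<lambda>u. U (exp u) powr (1 / (p - 1))) has_real_derivative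
      x powr (2 - p) / (p - 1) * (\<mu> + Y - h N p x)) (at \<tau>)" by simp
  have "((\<lambda>r. r powr (p + s)) has_real_derivative r powr (p + s) * ((p + s) * (1 / r))) (at r)"
    using r by (intro powr_has_log_derivative) auto
  moreover have "((\<lambda>r. v r powr m) has_real_derivative v r powr m * (m * (deriv v r / v r))) (at r)"
    using r v_deriv[OF r(1)] by (intro powr_has_log_derivative) auto
  ultimately have "((\<lambda>r. r powr (p + s) * v r powr m) has_real_derivative
      r powr (p + s) * ((p + s) * (1 / r)) * v r powr m
      + v r powr m * (m * (deriv v r / v r)) * r powr (p + s)) (at r)"
    by (rule DERIV_mult)
  \<comment> \<open>Since \<open>p + s = \<gamma> * m\<close> and
    \<open>r * deriv v r / v r = - x\<close>, the two logarithmic derivatives combine into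
    \<open>m * (\<gamma> - x) / r\<close>.\<close>
  moreover have "r powr (p + s) * ((p + s) * (1 / r)) * v r powr m
      + v r powr m * (m * (deriv v r / v r)) * r powr (p + s) = m * Y * (\<gamma> - x) / r"
  proof -
    have *: "A * (g * k * (1 / r)) * C + C * (k * (- x / r)) * A = k * (A * C) * (g - x) / r"
      for A C g k :: real
      using r(2) by (simp add: field_simps)
    have "deriv v r / v r = - x / r" using r by (simp add: x_def)
    then show ?thesis
      using *[of "r powr (p + s)" \<gamma> m "v r powr m"] unfolding Y_def by (simp only: gamma_mult_m)
  qed
  ultimately have "((\<lambda>r. r powr (p + s) * v r powr m) has_real_derivative m * Y * (\<gamma> - x) / r) (at (exp \<tau>))"
    by (simp add: r_def)
  from DERIV_chain2[OF this DERIV_exp]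
  have dY: "((\<lambda>u. exp u powr (p + s) * v (exp u) powr m) has_real_derivative m * Y * (\<gamma> - x)) (at \<tau>)"
    using r by (simp add: r_def)
  show "(orbit p s q v has_vector_derivative field_S N p s \<mu> q (orbit p s q v \<tau>)) (at \<tau> within {t..})"
  \<comment> \<open>The expression through \<open>U\<close> is known to agree with the orbit where
    \<open>v' < 0\<close>, that is from \<open>t\<close> on; hence the derivative within
    \<open>{t..}\<close>.\<close>
  proof (rule has_vector_derivative_transform)
    show "\<tau> \<in> {t..}" using \<open>t \<le> \<tau>\<close> by simp
    show "orbit p s q v u = (U (exp u) powr (1 / (p - 1)), exp u powr (p + s) * v (exp u) powr m)"
      if "u \<in> {t..}" for u
      using root[of u] that by (simp add: orbit_def Let_def)
    show "((\<lambda>u. (U (exp u) powr (1 / (p - 1)), exp u powr (p + s) * v (exp u) powr m))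
        has_vector_derivative field_S N p s \<mu> q (orbit p s q v \<tau>)) (at \<tau> within {t..})"
      unfolding orb field_S_def prod.case
      by (rule has_vector_derivative_at_within, rule has_vector_derivative_Pair)
         (use dx dY in \<open>simp_all add: has_real_derivative_iff_has_vector_derivative\<close>)
  qed
qed

lemma radial_solution_limits:
  assumes t: "ln R\<^sub>0 < t" and W: "orbit p s q v t \<in> sublevel"
  shows "((\<lambda>r. r powr \<gamma> * v r) \<longlongrightarrow> Ys powr (1 / m)) at_top"
    and "((\<lambda>r. r * deriv v r / v r) \<longlongrightarrow> - \<gamma>) at_top"
proof -
  have R: "R\<^sub>0 < exp t" using t R0 by (metis exp_less_mono exp_ln)
  \<comment> \<open>Membership in the quadrant provides the negative derivative at the entry time,
    from which the sign propagates.\<close>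
  have "0 < - (exp t * deriv v (exp t) / v (exp t))"
    using W by (simp add: sublevel_def quadrant_def orbit_def Let_def)
  then have "deriv v (exp t) < 0"
    using v_pos[OF R] by (simp add: divide_less_0_iff mult_less_0_iff)
  then have neg: "deriv v (exp u) < 0" if "t \<le> u" for u
    using deriv_neg_persists[OF R] that by simp
  have "solves_S N p s \<mu> q {t..} (orbit p s q v)"
    unfolding solves_S_def
    using orbit_has_vector_derivative[OF t neg] by (auto simp: is_interval_ci)
  note lim = solves_converges[OF this W]
  have "((\<lambda>r. - fst (orbit p s q v (ln r))) \<longlongrightarrow> - \<gamma>) at_top"
    by (intro tendsto_minus filterlim_compose[OF lim(1)] ln_at_top)
  then show "((\<lambda>r. r * deriv v r / v r) \<longlongrightarrow> - \<gamma>) at_top"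
    by (rule Lim_transform_eventually)
       (auto simp: orbit_def Let_def intro: eventually_mono[OF eventually_gt_at_top[of 0]])
  \<comment> \<open>As \<open>(p + s) / m = \<gamma>\<close>, the power \<open>1 / m\<close> of the
    second coordinate is \<open>r powr \<gamma> * v r\<close>.\<close>
  have "((\<lambda>r. snd (orbit p s q v (ln r)) powr (1 / m)) \<longlongrightarrow> Ys powr (1 / m)) at_top"
    using Ys_pos by (intro tendsto_intros filterlim_compose[OF lim(2)] ln_at_top) auto
  then show "((\<lambda>r. r powr \<gamma> * v r) \<longlongrightarrow> Ys powr (1 / m)) at_top"
  proof (rule Lim_transform_eventually)
    show "eventually (\<lambda>r. snd (orbit p s q v (ln r)) powr (1 / m) = r powr \<gamma> * v r) at_top"
      using eventually_gt_at_top[of R\<^sub>0]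
    proof eventually_elim
      case (elim r)
      then have "0 < r" "0 < v r" using R0 v_pos by auto
      then show ?case
        using m_pos by (simp add: orbit_def Let_def powr_mult powr_powr gamma_star_def)
    qed
  qed
qed

end

end

theorem theorem1p10:
  fixes N p s \<mu> q :: real
  assumes "1 < p" and "p < N" and "- p < s"
    and "0 < \<mu>" and "\<mu> < mu_bar N p"
    and "p_star N p s - 1 < q" and "q < q_bar N p s \<mu>"
  shows "\<mu> < h N p (gamma_star p s q)
    \<and> (\<forall>I z. solves_S N p s \<mu> q I z \<longrightarrow>
         (\<forall>t\<in>I. ((\<lambda>\<tau>. V N p s \<mu> q (z \<tau>)) has_real_derivative
            - (q - p + 1) * (fst (z t) - gamma_star p s q)
              * (h N p (fst (z t)) - h N p (gamma_star p s q))) (at t within I)))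
    \<and> (\<exists>!g. g \<in> {(N - p) / p<..<(N - p) / (p - 1)} \<and> h N p g = h N p (gamma_star p s q))
    \<and> (\<forall>z\<in>strip N p s q. V N p s \<mu> q differentiable (at z) \<and> V_dot N p s \<mu> q z \<le> 0
         \<and> (V_dot N p s \<mu> q z = 0 \<longleftrightarrow> fst z = gamma_star p s q))
    \<and> open (basin N p s \<mu> q)
    \<and> bounded (basin N p s \<mu> q)
    \<and> forward_invariant_S N p s \<mu> q (basin N p s \<mu> q)
    \<and> P_star N p s \<mu> q \<in> basin N p s \<mu> q
    \<and> basin N p s \<mu> q \<subseteq> strip N p s q
    \<and> (\<forall>R\<^sub>0 v. 0 < R\<^sub>0 \<and> radial_solution N p s \<mu> q R\<^sub>0 v
         \<and> (\<exists>t>ln R\<^sub>0. orbit p s q v t \<in> basin N p s \<mu> q) \<longrightarrow>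
         ((\<lambda>r. r powr gamma_star p s q * v r) \<longlongrightarrow>
            (h N p (gamma_star p s q) - \<mu>) powr (1 / (q - p + 1))) at_top
         \<and> ((\<lambda>r. r * deriv v r / v r) \<longlongrightarrow> - gamma_star p s q) at_top)"
proof -
  interpret supercritical N p s \<mu> q
    using assms by unfold_locales
  have strip: "VV differentiable (at z)" "V_dot N p s \<mu> q z \<le> 0"
      "V_dot N p s \<mu> q z = 0 \<longleftrightarrow> fst z = \<gamma>" if "z \<in> strip N p s q" for z
  proof -
    have z: "z \<in> quadrant" "0 < fst z" "fst z < \<gamma>\<^sub>1"
      using that by (auto simp: strip_def quadrant_def)
    have "V_dot N p s \<mu> q z = - (m * ((fst z - \<gamma>) * (h N p (fst z) - h N p \<gamma>)))"
      unfolding V_dot_eq[OF z(1)] by (simp only: mult.assoc mult_minus_left)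
    then show "V_dot N p s \<mu> q z \<le> 0" "V_dot N p s \<mu> q z = 0 \<longleftrightarrow> fst z = \<gamma>"
      using h_sign[OF z(2,3)] m_pos by simp_all
    show "VV differentiable (at z)"
      using V_has_derivative[OF z(1)] by (rule differentiableI)
  qed
  have limits: "((\<lambda>r. r powr \<gamma> * v r) \<longlongrightarrow> (h N p \<gamma> - \<mu>) powr (1 / m)) at_top"
      "((\<lambda>r. r * deriv v r / v r) \<longlongrightarrow> - \<gamma>) at_top"
    if "0 < R\<^sub>0 \<and> radial_solution N p s \<mu> q R\<^sub>0 v \<and> (\<exists>t>ln R\<^sub>0. orbit p s q v t \<in> sublevel)" for R\<^sub>0 v
    using that radial_solution_limits[of R\<^sub>0 v] unfolding Y_star_def by blast+
  show ?thesis
    unfolding basin_eq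
    by (intro conjI allI impI ballI mu_less_h_gamma ex1_sharp sublevel_open sublevel_bounded
        sublevel_forward_invariant P_star_in_sublevel sublevel_strip)
       (assumption | rule solves_V_deriv strip limits)+
qed

end
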